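(* For every station $i$, i.e. for every probability distribution $p_i$ on finite $\pm1$ sequences and all integers $0\le l_i\le u_i$, the extended user dissatisfaction function $c_i:\mathbb Z^2\to\mathbb R\cup\{\infty\}$ is multimodular.
   Context: For a finite sequence $X=(X_1,\dots,X_s)\in\{\pm1\}^s$ ($X_t=1$: a customer attempts to return a bike, $X_t=-1$: a customer attempts to rent a bike) and integers $d,b\ge0$ (initial numbers of empty docks and of bikes), let $\delta_0=d$ and $\delta_t=\max\{0,\min\{d+b,\delta_{t-1}-X_t\}\}$, and $$c^X(d,b)=|\{t:X_t=1,\ \delta_{t-1}=0\}|+|\{t:X_t=-1,\ \delta_{t-1}=d+b\}|,$$ the number of out-of-stock events. Station $i$ has a probability distribution $p_i$ on finite $\pm1$ sequences and integers $0\le l_i\le u_i$. Its extended user dissatisfaction function is $c_i(d,b)=\mathbb E_{X\sim p_i}[c^X(d,b)]$ if $d,b\ge0$ and $l_i\le d+b\le u_i$, and $c_i(d,b)=\infty$ for all other $(d,b)\in\mathbb Z^2$. A function $f:\mathbb Z^2\to\mathbb R\cup\{\infty\}$ is multimodular if for all $d,b\in\mathbb Z$: (1) $f(d+1,b+1)+f(d,b)\ge f(d+1,b)+f(d,b+1)$; (2) $f(d-1,b+1)+f(d,b-1)\ge f(d-1,b)+f(d,b)$; (3) $f(d+1,b-1)+f(d-1,b)\ge f(d,b-1)+f(d,b)$, with the usual conventions for sums in $\mathbb R\cup\{\infty\}$. *)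

theory Defs
  imports "HOL-Probability.Probability"
begin

text \<open>
  A customer sequence \<open>(X\<^sub>1, \<dots>, X\<^sub>s)\<close> is a list over \<open>{-1, 1}\<close>. Lists are indexed from 0, so
  \<open>X\<^sub>t\<^sub>+\<^sub>1\<close> is \<open>X ! t\<close>.
\<close>

definition pm_seqs :: "int list set" where
  "pm_seqs = {X. set X \<subseteq> {-1, 1}}"

fun open_docks :: "int list \<Rightarrow> int \<Rightarrow> int \<Rightarrow> nat \<Rightarrow> int" where
  "open_docks X d b 0 = d"
| "open_docks X d b (Suc t) = max 0 (min (d + b) (open_docks X d b t - X ! t))"

definition out_of_stock_events :: "int list \<Rightarrow> int \<Rightarrow> int \<Rightarrow> nat" where
  "out_of_stock_events X d b =
     card {t. t < length X \<and> X ! t = 1 \<and> open_docks X d b t = 0}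
   + card {t. t < length X \<and> X ! t = -1 \<and> open_docks X d b t = d + b}"

text \<open>
  The expectation of the nonnegative count is the nonnegative Lebesgue integral, which is defined
  for every distribution; it is \<open>\<infinity>\<close> if the count is not integrable (possible when the sequence
  lengths are unbounded) and agrees with the Bochner integral otherwise.
\<close>

definition extended_udf :: "int list pmf \<Rightarrow> int \<Rightarrow> int \<Rightarrow> int \<Rightarrow> int \<Rightarrow> ereal" where
  "extended_udf p l u d b =
     (if 0 \<le> d \<and> 0 \<le> b \<and> l \<le> d + b \<and> d + b \<le> u
      then enn2ereal (\<integral>\<^sup>+ X. of_nat (out_of_stock_events X d b) \<partial>measure_pmf p)
      else \<infinity>)"

text \<open>
  The first conjunct says that \<open>f\<close> takes values in \<open>\<real> \<union> {\<infinity>}\<close>, so that no sum below is of the form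
  \<open>\<infinity> + (-\<infinity>)\<close>.
\<close>

definition multimodular :: "(int \<Rightarrow> int \<Rightarrow> ereal) \<Rightarrow> bool" where
  "multimodular f \<longleftrightarrow>
     (\<forall>d b. f d b \<noteq> -\<infinity>) \<and>
     (\<forall>d b. f (d + 1) (b + 1) + f d b \<ge> f (d + 1) b + f d (b + 1)) \<and>
     (\<forall>d b. f (d - 1) (b + 1) + f d (b - 1) \<ge> f (d - 1) b + f d b) \<and>
     (\<forall>d b. f (d + 1) (b - 1) + f (d - 1) b \<ge> f d (b - 1) + f d b)"

end

theory Submission
  imports Defs
begin

text \<open>
  Conditioning on the first customer turns the number of out-of-stock events into a dynamic
  program: a return maps a cost-to-go function \<open>f\<close> of (empty docks, bikes) to the function that
  is \<open>f\<close> shifted along the line \<open>d + b = const\<close>, except on the edge \<open>d = 0\<close>, where the state stays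
  put and one event is paid. A rental does the same with the two coordinates exchanged. Hence it
  suffices to find a property of functions on the nonnegative quadrant that holds for the zero
  function, is invariant under exchanging the coordinates, and survives the return operator.

  Multimodularity alone is not such a property. Away from the edge \<open>d = 0\<close> the operator merely
  shifts the inequalities, but on the edge the third inequality turns into the bound
  \<open>f 0 (b + 2) \<le> 1 + f 1 (b + 1)\<close>: exchanging one empty dock for a bike costs at most one event.
  Adding this bound and its mirror image to the multimodular inequalities makes the
  induction close (\<open>regular_return_cost\<close>).

  The inequalities for single sequences integrate to inequalities for the expectation, and
  the value \<open>\<infinity>\<close> outside the feasible region does no harm: whenever both points on the larger side
  of a multimodular inequality are feasible, so are both points on the smaller side.
\<close>

section \<open>Cost functions on the nonnegative quadrant\<close>

text \<open>
  The first three inequalities are those of multimodularity, translated so that every point that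
  occurs lies in the quadrant exactly when \<open>d\<close> and \<open>b\<close> are nonnegative. The last two bound the
  change along a line of constant capacity.
\<close>

definition regular :: "(int \<Rightarrow> int \<Rightarrow> nat) \<Rightarrow> bool" where
  "regular f \<longleftrightarrow> (\<forall>d\<ge>0. \<forall>b\<ge>0.
     f (d + 1) b + f d (b + 1) \<le> f (d + 1) (b + 1) + f d b \<and>
     f d (b + 1) + f (d + 1) (b + 1) \<le> f d (b + 2) + f (d + 1) b \<and>
     f (d + 1) b + f (d + 1) (b + 1) \<le> f (d + 2) b + f d (b + 1) \<and>
     f d (b + 1) \<le> 1 + f (d + 1) b \<and>
     f (d + 1) b \<le> 1 + f d (b + 1))"

definition return_cost :: "(int \<Rightarrow> int \<Rightarrow> nat) \<Rightarrow> int \<Rightarrow> int \<Rightarrow> nat" where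
  "return_cost f d b = (if d = 0 then 1 + f 0 b else f (d - 1) (b + 1))"

definition rental_cost :: "(int \<Rightarrow> int \<Rightarrow> nat) \<Rightarrow> int \<Rightarrow> int \<Rightarrow> nat" where
  "rental_cost f d b = (if b = 0 then 1 + f d 0 else f (d + 1) (b - 1))"

lemma regularD:
  assumes "regular f" "0 \<le> d" "0 \<le> b"
  shows "f (d + 1) b + f d (b + 1) \<le> f (d + 1) (b + 1) + f d b"
    and "f d (b + 1) + f (d + 1) (b + 1) \<le> f d (b + 2) + f (d + 1) b"
    and "f (d + 1) b + f (d + 1) (b + 1) \<le> f (d + 2) b + f d (b + 1)"
    and "f d (b + 1) \<le> 1 + f (d + 1) b"
    and "f (d + 1) b \<le> 1 + f d (b + 1)"
  using assms unfolding regular_def by blast+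

lemma regular_swap:
  assumes "regular f"
  shows "regular (\<lambda>d b. f b d)"
  unfolding regular_def using regularD[OF assms] by (auto simp: add.commute)

text \<open>
  For \<open>d > 0\<close> every inequality is an instance of the same inequality for \<open>f\<close>. On the edge
  \<open>d = 0\<close>, the first becomes convexity of \<open>f 0\<close>, which is the sum of the first two inequalities
  for \<open>f\<close>; the third becomes the bound on the change along a line of constant capacity; the
  others are trivial.
\<close>

lemma regular_return_cost:
  assumes f: "regular f"
  shows "regular (return_cost f)"
  unfolding regular_def
proof (intro allI impI)
  fix d b :: int
  assume d: "0 \<le> d" and b: "0 \<le> b"
  let ?g = "return_cost f"
  show "?g (d + 1) b + ?g d (b + 1) \<le> ?g (d + 1) (b + 1) + ?g d b \<and>
     ?g d (b + 1) + ?g (d + 1) (b + 1) \<le> ?g d (b + 2) + ?g (d + 1) b \<and>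
     ?g (d + 1) b + ?g (d + 1) (b + 1) \<le> ?g (d + 2) b + ?g d (b + 1) \<and>
     ?g d (b + 1) \<le> 1 + ?g (d + 1) b \<and>
     ?g (d + 1) b \<le> 1 + ?g d (b + 1)"
  proof (cases "d = 0")
    case True
    have "2 * f 0 (b + 1) \<le> f 0 (b + 2) + f 0 b"
      using regularD(1,2)[OF f, of 0 b] b by simp
    moreover have "f 0 (b + 2) \<le> 1 + f 1 (b + 1)"
      using regularD(4)[OF f, of 0 "b + 1"] b by (simp add: add.assoc)
    ultimately show ?thesis
      using True by (simp add: return_cost_def add.assoc)
  next
    case False
    then show ?thesis
      using regularD[OF f, of "d - 1" "b + 1"] d b
      by (simp add: return_cost_def add.assoc add.commute)
  qed
qed

lemma regular_rental_cost:
  assumes "regular f"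
  shows "regular (rental_cost f)"
proof -
  have "rental_cost f = (\<lambda>d b. return_cost (\<lambda>d b. f b d) b d)"
    by (simp add: fun_eq_iff rental_cost_def return_cost_def)
  then show ?thesis
    using assms by (simp add: regular_swap regular_return_cost)
qed

section \<open>Recursion over the customer sequence\<close>

lemma card_less_Suc_Collect:
  "card {t. t < Suc n \<and> P t} = of_bool (P 0) + card {t. t < n \<and> P (Suc t)}"
proof -
  have "{t. t < Suc n \<and> P t} = {t. t = 0 \<and> P 0} \<union> Suc ` {t. t < n \<and> P (Suc t)}"
    by (auto simp: image_iff less_Suc_eq_0_disj)
  also have "card \<dots> = card {t::nat. t = 0 \<and> P 0} + card (Suc ` {t. t < n \<and> P (Suc t)})"
    by (rule card_Un_disjoint) auto
  finally show ?thesis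
    by (simp add: card_image)
qed

text \<open>After the first customer the capacity \<open>d + b\<close> is unchanged, so the process restarts from the
  new number of docks and the correspondingly adjusted number of bikes.\<close>

lemma open_docks_Cons_Suc:
  assumes "d' = max 0 (min (d + b) (d - x))" and "d' + b' = d + b"
  shows "open_docks (x # X) d b (Suc t) = open_docks X d' b' t"
  using assms by (induction t) auto

lemma out_of_stock_events_Cons:
  assumes "d' = max 0 (min (d + b) (d - x))" and "d' + b' = d + b"
  shows "out_of_stock_events (x # X) d b =
    of_bool (x = 1 \<and> d = 0) + of_bool (x = -1 \<and> b = 0) + out_of_stock_events X d' b'"
  unfolding out_of_stock_events_def
  by (simp only: length_Cons card_less_Suc_Collect nth_Cons_0 nth_Cons_Suc
      open_docks_Cons_Suc[OF assms] assms(2) open_docks.simps(1)) simp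

lemma out_of_stock_events_return:
  assumes "0 \<le> d" "0 \<le> b"
  shows "out_of_stock_events (1 # X) d b = return_cost (out_of_stock_events X) d b"
proof (cases "d = 0")
  case True
  then show ?thesis
    using out_of_stock_events_Cons[of 0 d b 1 b X] assms by (simp add: return_cost_def)
next
  case False
  then show ?thesis
    using out_of_stock_events_Cons[of "d - 1" d b 1 "b + 1" X] assms
    by (simp add: return_cost_def)
qed

lemma out_of_stock_events_rental:
  assumes "0 \<le> d" "0 \<le> b"
  shows "out_of_stock_events (-1 # X) d b = rental_cost (out_of_stock_events X) d b"
proof (cases "b = 0")
  case True
  then show ?thesis
    using out_of_stock_events_Cons[of d d b "-1" 0 X] assms by (simp add: rental_cost_def)
next
  case False
  then show ?thesis
    using out_of_stock_events_Cons[of "d + 1" d b "-1" "b - 1" X] assms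
    by (simp add: rental_cost_def)
qed

lemma regular_cong:
  assumes "regular g"
    and "\<And>d b. 0 \<le> d \<Longrightarrow> 0 \<le> b \<Longrightarrow> f d b = g d b"
  shows "regular f"
  using assms(1) unfolding regular_def by (simp add: assms(2))

lemma regular_out_of_stock_events:
  assumes "X \<in> pm_seqs"
  shows "regular (out_of_stock_events X)"
  using assms
proof (induction X)
  case Nil
  show ?case by (simp add: regular_def out_of_stock_events_def)
next
  case (Cons x X)
  then have IH: "regular (out_of_stock_events X)" and "x = 1 \<or> x = -1"
    by (auto simp: pm_seqs_def)
  then consider "x = 1" | "x = -1" by blast
  then show ?case
  proof cases
    case 1
    show ?thesis
      unfolding 1 by (rule regular_cong[OF regular_return_cost[OF IH] out_of_stock_events_return])
  next
    case 2
    show ?thesis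
      unfolding 2 by (rule regular_cong[OF regular_rental_cost[OF IH] out_of_stock_events_rental])
  qed
qed

section \<open>Passing to the expectation\<close>

lemma nn_integral_pmf_of_nat_add_mono:
  fixes f g h k :: "'a \<Rightarrow> nat"
  assumes "\<And>x. x \<in> set_pmf p \<Longrightarrow> f x + g x \<le> h x + k x"
  shows "(\<integral>\<^sup>+x. of_nat (f x) \<partial>measure_pmf p) + (\<integral>\<^sup>+x. of_nat (g x) \<partial>measure_pmf p)
    \<le> (\<integral>\<^sup>+x. of_nat (h x) \<partial>measure_pmf p) + (\<integral>\<^sup>+x. of_nat (k x) \<partial>measure_pmf p)"
proof -
  have "(\<integral>\<^sup>+x. of_nat (f x) + of_nat (g x) \<partial>measure_pmf p)
    \<le> (\<integral>\<^sup>+x. of_nat (h x) + of_nat (k x) \<partial>measure_pmf p)"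
    by (intro nn_integral_mono_AE AE_pmfI)
      (simp only: of_nat_add[symmetric] of_nat_le_iff assms)
  then show ?thesis
    by (simp add: nn_integral_add)
qed

text \<open>
  If a point on the larger side is infeasible, that side is \<open>\<infinity>\<close>, since no value is \<open>-\<infinity>\<close>. So the
  remaining obligations may assume that the larger side is feasible; for multimodularity this is
  what keeps all points inside the quadrant, where the cost functions are regular.
\<close>

lemma extended_udf_add_mono:
  fixes p :: "int list pmf" and l u :: int
  defines "feas \<equiv> \<lambda>d b. 0 \<le> d \<and> 0 \<le> b \<and> l \<le> d + b \<and> d + b \<le> u"
  assumes closed: "feas d3 b3 \<Longrightarrow> feas d4 b4 \<Longrightarrow> feas d1 b1 \<and> feas d2 b2"
    and le: "\<And>X. feas d3 b3 \<Longrightarrow> feas d4 b4 \<Longrightarrow> X \<in> set_pmf p \<Longrightarrow>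
      out_of_stock_events X d1 b1 + out_of_stock_events X d2 b2
        \<le> out_of_stock_events X d3 b3 + out_of_stock_events X d4 b4"
  shows "extended_udf p l u d1 b1 + extended_udf p l u d2 b2
    \<le> extended_udf p l u d3 b3 + extended_udf p l u d4 b4"
proof (cases "feas d3 b3 \<and> feas d4 b4")
  case True
  have udf: "extended_udf p l u d b =
      enn2ereal (\<integral>\<^sup>+X. of_nat (out_of_stock_events X d b) \<partial>measure_pmf p)" if "feas d b" for d b
    using that unfolding feas_def extended_udf_def by simp
  show ?thesis
    using closed True nn_integral_pmf_of_nat_add_mono[OF le]
    by (simp add: udf plus_ennreal.rep_eq[symmetric] less_eq_ennreal.rep_eq[symmetric])
next
  case False
  then show ?thesis
    unfolding feas_def by (auto simp: extended_udf_def)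
qed

theorem lemma2p1:
  fixes p :: "int list pmf" and l u :: int
  assumes "set_pmf p \<subseteq> pm_seqs"
    and "0 \<le> l" and "l \<le> u"
  shows "multimodular (extended_udf p l u)"
proof -
  let ?feas = "\<lambda>d b. 0 \<le> d \<and> 0 \<le> b \<and> l \<le> d + b \<and> d + b \<le> u"
  have reg: "regular (out_of_stock_events X)" if "X \<in> set_pmf p" for X
    using that assms(1) regular_out_of_stock_events by blast
  show ?thesis
    unfolding multimodular_def
  proof (intro conjI allI)
    fix d b :: int
    show "extended_udf p l u d b \<noteq> -\<infinity>"
      by (simp add: extended_udf_def)
    show "extended_udf p l u (d + 1) b + extended_udf p l u d (b + 1)
        \<le> extended_udf p l u (d + 1) (b + 1) + extended_udf p l u d b"
      by (rule extended_udf_add_mono) (auto intro: regularD(1)[OF reg])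
    show "extended_udf p l u (d - 1) b + extended_udf p l u d b
        \<le> extended_udf p l u (d - 1) (b + 1) + extended_udf p l u d (b - 1)"
    proof (rule extended_udf_add_mono)
      fix X assume "X \<in> set_pmf p" "?feas (d - 1) (b + 1)" "?feas d (b - 1)"
      then show "out_of_stock_events X (d - 1) b + out_of_stock_events X d b
          \<le> out_of_stock_events X (d - 1) (b + 1) + out_of_stock_events X d (b - 1)"
        using regularD(2)[OF reg, of X "d - 1" "b - 1"] by (simp add: algebra_simps)
    qed auto
    show "extended_udf p l u d (b - 1) + extended_udf p l u d b
        \<le> extended_udf p l u (d + 1) (b - 1) + extended_udf p l u (d - 1) b"
    proof (rule extended_udf_add_mono)
      fix X assume "X \<in> set_pmf p" "?feas (d + 1) (b - 1)" "?feas (d - 1) b"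
      then show "out_of_stock_events X d (b - 1) + out_of_stock_events X d b
          \<le> out_of_stock_events X (d + 1) (b - 1) + out_of_stock_events X (d - 1) b"
        using regularD(3)[OF reg, of X "d - 1" "b - 1"] by (simp add: algebra_simps)
    qed auto
  qed
qed

end
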